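(* Let $n\ge 5$ and $2\le r\le n-3$ be integers. Then \[ m(n,1,r)=n-r+1. \]
   Context: All graphs are finite and simple. For a vertex $u$ of a graph $G$, $N[u]$ is its closed neighborhood (the set consisting of $u$ and all vertices adjacent to $u$). A set $S\subseteq V(G)$ is dominating if every vertex of $G$ lies in $N[s]$ for some $s\in S$. A vertex $u\in V(G)$ is overdominated by $S$ if $|N[u]\cap S|\ge 2$. The cardinality-redundance $CR(S)$ is the number of vertices of $G$ overdominated by $S$, and $CR(G)$ is the minimum of $CR(S)$ over all dominating sets $S$ of $G$. $\gamma_{CR}(G)$ is the minimum size of a dominating set $S$ with $CR(S)=CR(G)$. For integers $k\ge 0$ and $n,r\ge 1$ with $k\le n$, $r\le n$, $m(n,k,r)$ is the minimum of $|E(G)|$ over all graphs $G$ with $|V(G)|=n$, $CR(G)=k$ and $\gamma_{CR}(G)=r$; if no such graph exists, $m(n,k,r)=0$. *)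

theory Defs
  imports Main
begin

text \<open>A finite simple graph is given by its vertex set \<open>V\<close> and its edge set \<open>E\<close>, where an edge
  is the two-element set of its endpoints.\<close>

definition simple_graph :: "'a set \<Rightarrow> 'a set set \<Rightarrow> bool" where
  "simple_graph V E \<longleftrightarrow> finite V \<and> (\<forall>e\<in>E. e \<subseteq> V \<and> card e = 2)"

definition closed_nbhd :: "'a set \<Rightarrow> 'a set set \<Rightarrow> 'a \<Rightarrow> 'a set" where
  "closed_nbhd V E u = {u} \<union> {v \<in> V. {u, v} \<in> E}"

definition dominating :: "'a set \<Rightarrow> 'a set set \<Rightarrow> 'a set \<Rightarrow> bool" where
  "dominating V E S \<longleftrightarrow> S \<subseteq> V \<and> (\<forall>v\<in>V. \<exists>s\<in>S. v \<in> closed_nbhd V E s)"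

definition overdominated :: "'a set \<Rightarrow> 'a set set \<Rightarrow> 'a set \<Rightarrow> 'a \<Rightarrow> bool" where
  "overdominated V E S u \<longleftrightarrow> u \<in> V \<and> card (closed_nbhd V E u \<inter> S) \<ge> 2"

definition set_CR :: "'a set \<Rightarrow> 'a set set \<Rightarrow> 'a set \<Rightarrow> nat" where
  "set_CR V E S = card {u \<in> V. overdominated V E S u}"

text \<open>The minima below are attained for every finite simple graph, since \<open>V\<close> itself is
  dominating.\<close>

definition graph_CR :: "'a set \<Rightarrow> 'a set set \<Rightarrow> nat" where
  "graph_CR V E = (LEAST c. \<exists>S. dominating V E S \<and> set_CR V E S = c)"

definition gamma_CR :: "'a set \<Rightarrow> 'a set set \<Rightarrow> nat" where
  "gamma_CR V E =
     (LEAST s. \<exists>S. dominating V E S \<and> set_CR V E S = graph_CR V E \<and> card S = s)"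

text \<open>Every finite graph is isomorphic to one whose vertices are natural numbers, so it
  suffices to let \<open>V\<close> range over the sets of naturals of size \<open>n\<close>. The conjunct \<open>finite V\<close>
  in \<open>simple_graph\<close> keeps \<open>card V = 0\<close> from admitting infinite \<open>V\<close>.\<close>

definition edge_counts :: "nat \<Rightarrow> nat \<Rightarrow> nat \<Rightarrow> nat set" where
  "edge_counts n k r =
     {card E | (V :: nat set) E.
        simple_graph V E \<and> card V = n \<and> graph_CR V E = k \<and> gamma_CR V E = r}"

definition min_edges :: "nat \<Rightarrow> nat \<Rightarrow> nat \<Rightarrow> nat" where
  "min_edges n k r =
     (if edge_counts n k r = {} then 0 else (LEAST e. e \<in> edge_counts n k r))"

end

theory Submission
  imports Defs
begin

text \<open>Lower bound: let \<open>S\<close> be a dominating set of size \<open>r\<close> that overdominates some vertex \<open>u\<close>.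
  Choosing for every vertex outside \<open>S\<close> an edge into \<open>S\<close> gives \<open>n - r\<close> distinct edges. The
  vertex \<open>u\<close> yields one more: an edge inside \<open>S\<close> if \<open>u \<in> S\<close>, and a second edge from \<open>u\<close> into
  \<open>S\<close> otherwise. This is \<open>card_edges_ge_overdominated\<close>.

  Upper bound: take a star with centre \<open>0\<close> and at least three leaves, append
  a pendant vertex \<open>2\<close> to one leaf \<open>1\<close>, and add \<open>r - 2\<close> isolated vertices. Every dominating set
  contains all isolated vertices, a vertex of \<open>{1, 2}\<close> (to dominate \<open>2\<close>), and a vertex of the
  rest of the star (to dominate another leaf), so it has at least \<open>r\<close> elements. If it contains
  \<open>0\<close>, then \<open>1\<close> is overdominated because of the element in \<open>{1, 2}\<close>; if not, then it contains all
  the leaves other than \<open>1\<close>, of which there are at least two, and \<open>0\<close> is overdominated. The set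
  consisting of \<open>0\<close>, \<open>2\<close> and the isolated vertices has size \<open>r\<close> and overdominates only
  \<open>1\<close>; hence \<open>extremal_parameters\<close>. The star, which has \<open>n - r + 1\<close> vertices, and the pendant edge
  have \<open>n - r + 1\<close> edges together.\<close>

section \<open>The lower bound on the number of edges\<close>

lemma dominating_iff:
  "dominating V E S \<longleftrightarrow> S \<subseteq> V \<and> (\<forall>v\<in>V. closed_nbhd V E v \<inter> S \<noteq> {})"
proof -
  have "v \<in> closed_nbhd V E s \<longleftrightarrow> s \<in> closed_nbhd V E v" if "v \<in> V" "s \<in> V" for v s
    using that by (auto simp: closed_nbhd_def insert_commute)
  then show ?thesis unfolding dominating_def disjoint_iff by (meson subsetD)
qed

lemma overdominated_iff:
  assumes "finite V"
  shows "overdominated V E S u \<longleftrightarrow>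
    u \<in> V \<and> (\<exists>x\<in>closed_nbhd V E u \<inter> S. \<exists>y\<in>closed_nbhd V E u \<inter> S. x \<noteq> y)"
proof -
  have "finite (closed_nbhd V E u \<inter> S)"
    using assms by (simp add: closed_nbhd_def)
  from card_le_Suc0_iff_eq[OF this] show ?thesis
    unfolding overdominated_def by (auto simp: not_less_eq_eq numeral_2_eq_2)
qed

lemma card_edges_ge_overdominated:
  assumes G: "simple_graph V E" and S: "dominating V E S" and u: "overdominated V E S u"
  shows "card V - card S + 1 \<le> card E"
proof -
  have fV: "finite V" and SV: "S \<subseteq> V"
    using G S by (auto simp: simple_graph_def dominating_def)
  have "E \<subseteq> Pow V" using G by (auto simp: simple_graph_def)
  then have fE: "finite E" using fV by (meson finite_Pow_iff finite_subset)
  have "\<forall>v\<in>V - S. \<exists>s\<in>S. {v, s} \<in> E"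
    using S by (fastforce simp: dominating_def closed_nbhd_def insert_commute)
  then obtain f where f: "\<And>v. v \<in> V - S \<Longrightarrow> f v \<in> S \<and> {v, f v} \<in> E"
    by metis
  let ?F = "(\<lambda>v. {v, f v}) ` (V - S)"
  have "inj_on (\<lambda>v. {v, f v}) (V - S)"
    using f by (auto simp: inj_on_def doubleton_eq_iff)
  then have cF: "card ?F = card V - card S"
    using SV fV by (simp add: card_image card_Diff_subset finite_subset)
  from u obtain x y where uV: "u \<in> V" and xy: "x \<noteq> y" "x \<in> S" "y \<in> S"
      "x \<in> closed_nbhd V E u" "y \<in> closed_nbhd V E u"
    by (auto simp: overdominated_iff[OF fV])
  have "\<exists>z\<in>S. {u, z} \<in> E \<and> (u \<in> S \<or> z \<noteq> f u)"
    using xy by (auto simp: closed_nbhd_def)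
  then obtain z where z: "z \<in> S" "{u, z} \<in> E" "u \<in> S \<or> z \<noteq> f u" by blast
  then have "{u, z} \<notin> ?F"
    using f by (auto simp: doubleton_eq_iff)
  then have "card (insert {u, z} ?F) = card V - card S + 1"
    using fV cF by simp
  moreover have "insert {u, z} ?F \<subseteq> E" using f z by auto
  ultimately show ?thesis using card_mono[OF fE] by metis
qed

text \<open>Some dominating set realizes both parameters.\<close>

lemma gamma_CR_witness:
  assumes "simple_graph V E"
  obtains S where "dominating V E S" "set_CR V E S = graph_CR V E" "card S = gamma_CR V E"
proof -
  have "dominating V E V" by (auto simp: dominating_def closed_nbhd_def)
  then have "\<exists>c S. dominating V E S \<and> set_CR V E S = c" by blast
  then have "\<exists>S. dominating V E S \<and> set_CR V E S = graph_CR V E"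
    unfolding graph_CR_def by (rule LeastI_ex)
  then have "\<exists>s S. dominating V E S \<and> set_CR V E S = graph_CR V E \<and> card S = s" by blast
  then have "\<exists>S. dominating V E S \<and> set_CR V E S = graph_CR V E \<and> card S = gamma_CR V E"
    unfolding gamma_CR_def by (rule LeastI_ex)
  with that show ?thesis by blast
qed

section \<open>The extremal graph\<close>

text \<open>The edges of the extremal graph on the vertices \<open>{..<n}\<close>: vertex \<open>0\<close> is joined to \<open>1\<close> and to
  the leaves \<open>3, \<dots>, m - 1\<close>, and \<open>2\<close> hangs off \<open>1\<close>; the vertices from \<open>m\<close> on are isolated.\<close>

definition extremal_edges :: "nat \<Rightarrow> nat set set" where
  "extremal_edges m = insert {1, 2} ((\<lambda>v. {0, v}) ` insert 1 {3..<m})"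

lemma simple_graph_extremal:
  assumes "3 \<le> m" "m \<le> n"
  shows "simple_graph {..<n} (extremal_edges m)"
  using assms by (auto simp: simple_graph_def extremal_edges_def)

lemma card_extremal_edges:
  assumes "3 \<le> m"
  shows "card (extremal_edges m) = m - 1"
proof -
  have "inj_on (\<lambda>v. {0, v}) (insert 1 {3..<m})"
    by (auto simp: inj_on_def doubleton_eq_iff)
  then have "card ((\<lambda>v. {0, v}) ` insert 1 {3..<m}) = m - 2"
    using assms by (simp add: card_image)
  moreover have "{1, 2} \<notin> (\<lambda>v. {0, v}) ` insert 1 {3..<m}"
    by (auto simp: doubleton_eq_iff)
  ultimately show ?thesis
    using assms by (simp add: extremal_edges_def)
qed

lemma mem_extremal_edges_iff:
  "{a, b} \<in> extremal_edges m \<longleftrightarrow> (a = 1 \<and> b = 2) \<or> (a = 2 \<and> b = 1) \<or>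
    (a = 0 \<and> (b = 1 \<or> 3 \<le> b \<and> b < m)) \<or> (b = 0 \<and> (a = 1 \<or> 3 \<le> a \<and> a < m))"
  unfolding extremal_edges_def insert_iff image_iff doubleton_eq_iff Bex_def atLeastLessThan_iff
  by blast

lemma closed_nbhd_extremal:
  assumes "3 \<le> m" "m \<le> n"
  shows "closed_nbhd {..<n} (extremal_edges m) 0 = {0, 1} \<union> {3..<m}"
    and "closed_nbhd {..<n} (extremal_edges m) 1 = {0, 1, 2}"
    and "closed_nbhd {..<n} (extremal_edges m) 2 = {1, 2}"
    and "3 \<le> u \<Longrightarrow> u < m \<Longrightarrow> closed_nbhd {..<n} (extremal_edges m) u = {0, u}"
    and "m \<le> u \<Longrightarrow> closed_nbhd {..<n} (extremal_edges m) u = {u}"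
  using assms unfolding closed_nbhd_def mem_extremal_edges_iff by auto

lemma dominating_extremal_imp:
  assumes m: "3 \<le> m" "m \<le> n" and S: "dominating {..<n} (extremal_edges m) S"
  shows "1 \<in> S \<or> 2 \<in> S"
    and "3 \<le> v \<Longrightarrow> v < m \<Longrightarrow> 0 \<in> S \<or> v \<in> S"
    and "{m..<n} \<subseteq> S"
proof -
  have meets: "closed_nbhd {..<n} (extremal_edges m) v \<inter> S \<noteq> {}" if "v < n" for v
    using S that by (auto simp: dominating_iff)
  show "1 \<in> S \<or> 2 \<in> S"
    using meets[of 2] m unfolding closed_nbhd_extremal(3)[OF m] by simp
  show "0 \<in> S \<or> v \<in> S" if "3 \<le> v" "v < m"
    using meets[of v] m that unfolding closed_nbhd_extremal(4)[OF m that] by simp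
  show "{m..<n} \<subseteq> S"
  proof
    fix v assume "v \<in> {m..<n}"
    then show "v \<in> S" using meets[of v] closed_nbhd_extremal(5)[OF m, of v] by simp
  qed
qed

lemma extremal_overdominated:
  assumes m: "5 \<le> m" "m \<le> n" and S: "dominating {..<n} (extremal_edges m) S"
  shows "\<exists>u. overdominated {..<n} (extremal_edges m) S u"
proof -
  have m3: "3 \<le> m" using m by simp
  show ?thesis
  proof (cases "0 \<in> S")
    case True
    obtain y where "y \<in> S" "y = 1 \<or> y = 2"
      using dominating_extremal_imp(1)[OF m3 m(2) S] by blast
    then have "overdominated {..<n} (extremal_edges m) S 1"
      using m True unfolding overdominated_iff[OF finite_lessThan]
        closed_nbhd_extremal(2)[OF m3 m(2)]
      by (intro conjI bexI[of _ 0] bexI[of _ y]) auto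
    then show ?thesis ..
  next
    case False
    \<comment> \<open>There are at least two leaves at \<open>0\<close> besides \<open>1\<close>, namely \<open>3\<close> and \<open>4\<close>.\<close>
    then have "3 \<in> S" "4 \<in> S"
      using dominating_extremal_imp(2)[OF m3 m(2) S, of 3]
        dominating_extremal_imp(2)[OF m3 m(2) S, of 4] m by auto
    then have "overdominated {..<n} (extremal_edges m) S 0"
      using m unfolding overdominated_iff[OF finite_lessThan]
        closed_nbhd_extremal(1)[OF m3 m(2)]
      by (intro conjI bexI[of _ 3] bexI[of _ 4]) auto
    then show ?thesis ..
  qed
qed

lemma extremal_dominating_card_ge:
  assumes m: "4 \<le> m" "m \<le> n" and S: "dominating {..<n} (extremal_edges m) S"
  shows "n - m + 2 \<le> card S"
proof -
  have m3: "3 \<le> m" using m by simp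
  have "S \<subseteq> {..<n}" using S by (simp add: dominating_def)
  then have fin: "finite S" by (rule finite_subset) simp
  obtain x where x: "x \<in> S" "x = 0 \<or> x = 3"
    using dominating_extremal_imp(2)[OF m3 m(2) S, of 3] m by auto
  obtain y where y: "y \<in> S" "y = 1 \<or> y = 2"
    using dominating_extremal_imp(1)[OF m3 m(2) S] by blast
  have "x \<notin> insert y {m..<n}" "y \<notin> {m..<n}"
    using x y m by auto
  then have "card (insert x (insert y {m..<n})) = n - m + 2"
    by simp
  moreover have "insert x (insert y {m..<n}) \<subseteq> S"
    using x y dominating_extremal_imp(3)[OF m3 m(2) S] by simp
  ultimately show ?thesis using card_mono[OF fin] by metis
qed

lemma extremal_parameters:
  assumes m: "5 \<le> m" "m \<le> n"
  shows "graph_CR {..<n} (extremal_edges m) = 1"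
    and "gamma_CR {..<n} (extremal_edges m) = n - m + 2"
proof -
  let ?V = "{..<n}" and ?E = "extremal_edges m"
  let ?T = "{0, 2} \<union> {m..<n}"
  have m3: "3 \<le> m" using m by simp
  note nbhd = closed_nbhd_extremal[OF m3 m(2)]
  \<comment> \<open>Every closed neighbourhood meets \<open>?T\<close> in a single vertex, except that of \<open>1\<close>.\<close>
  have meet: "closed_nbhd ?V ?E v \<inter> ?T =
      (if v = 1 then {0, 2} else if v = 2 then {2} else if v < m then {0} else {v})"
    if "v < n" for v
  proof -
    consider "v = 0" | "v = 1" | "v = 2" | "3 \<le> v" "v < m" | "m \<le> v" by linarith
    then show ?thesis
    proof cases
      case 1
      then show ?thesis using m unfolding 1 nbhd(1) by auto
    next
      case 2
      then show ?thesis using m unfolding 2 nbhd(2) by auto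
    next
      case 3
      then show ?thesis using m unfolding 3 nbhd(3) by auto
    next
      case 4
      then show ?thesis unfolding nbhd(4)[OF 4] by auto
    next
      case 5
      then show ?thesis using m that unfolding nbhd(5)[OF 5] by auto
    qed
  qed
  have "?T \<subseteq> ?V" using m by auto
  then have dom: "dominating ?V ?E ?T"
    unfolding dominating_iff using meet by simp
  have over: "overdominated ?V ?E ?T v \<longleftrightarrow> v = 1" for v
  proof (cases "v < n")
    case True
    then show ?thesis unfolding overdominated_def meet[OF True] by simp
  next
    case False
    then show ?thesis using m by (auto simp: overdominated_def)
  qed
  have "{u \<in> ?V. overdominated ?V ?E ?T u} = {1}"
    unfolding over using m by auto
  then have CR: "set_CR ?V ?E ?T = 1" by (simp add: set_CR_def)
  have card: "card ?T = n - m + 2"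
    using m by simp
  have ge1: "1 \<le> set_CR ?V ?E S" if "dominating ?V ?E S" for S
  proof -
    have "{u \<in> ?V. overdominated ?V ?E S u} \<noteq> {}"
      using extremal_overdominated[OF m that] by (auto simp: overdominated_def)
    then show ?thesis by (simp add: set_CR_def Suc_le_eq card_gt_0_iff)
  qed
  show gCR: "graph_CR ?V ?E = 1"
    unfolding graph_CR_def using dom CR ge1 by (intro Least_equality) blast+
  show "gamma_CR ?V ?E = n - m + 2"
    unfolding gamma_CR_def gCR
  proof (rule Least_equality)
    show "\<exists>S. dominating ?V ?E S \<and> set_CR ?V ?E S = 1 \<and> card S = n - m + 2"
      using dom CR card by blast
    show "n - m + 2 \<le> s" if "\<exists>S. dominating ?V ?E S \<and> set_CR ?V ?E S = 1 \<and> card S = s" for s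
      using that extremal_dominating_card_ge[of m n] m by auto
  qed
qed

section \<open>The minimum number of edges\<close>

theorem theorem4p3:
  fixes n r :: nat
  assumes "n \<ge> 5" and "2 \<le> r" and "r \<le> n - 3"
  shows "min_edges n 1 r = n - r + 1"
proof -
  \<comment> \<open>The non-trivial component has \<open>n - (r - 2)\<close> vertices.\<close>
  let ?m = "n - r + 2"
  have m: "5 \<le> ?m" "?m \<le> n" using assms by auto
  have "simple_graph {..<n} (extremal_edges ?m)"
    using m by (intro simple_graph_extremal) auto
  moreover have "card (extremal_edges ?m) = n - r + 1"
    using card_extremal_edges[of ?m] m by simp
  moreover have "gamma_CR {..<n} (extremal_edges ?m) = r"
    using extremal_parameters(2)[OF m] assms by simp
  ultimately have mem: "n - r + 1 \<in> edge_counts n 1 r"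
    using extremal_parameters(1)[OF m] card_lessThan[of n]
    unfolding edge_counts_def by (smt (verit) mem_Collect_eq)
  have "n - r + 1 \<le> e" if "e \<in> edge_counts n 1 r" for e
  proof -
    from that obtain V :: "nat set" and E where G: "simple_graph V E" "card V = n"
        "graph_CR V E = 1" "gamma_CR V E = r" "e = card E"
      by (auto simp: edge_counts_def)
    obtain S where S: "dominating V E S" "set_CR V E S = 1" "card S = r"
      using gamma_CR_witness[OF G(1)] G by metis
    then have "{u \<in> V. overdominated V E S u} \<noteq> {}"
      by (metis card.empty set_CR_def zero_neq_one)
    then obtain u where "overdominated V E S u" by blast
    from card_edges_ge_overdominated[OF G(1) S(1) this] show ?thesis
      using G S by simp
  qed
  with mem have "(LEAST e. e \<in> edge_counts n 1 r) = n - r + 1"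
    by (intro Least_equality)
  with mem show ?thesis by (auto simp: min_edges_def)
qed

end
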